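(* Let $\omega$ be the linear order of nonnegative integers understood as a thin category, and let $\mathbf{C}$ be a Ramsey category of finite objects. If $\mathbf{C}$ is thin, then $\mathbf{C}\equiv_T 1$ or $\mathbf{C}\equiv_T\omega$. If, however, $\mathbf{C}$ is not thin, then $\omega<_T\mathbf{C}$. (Here, $1$ denotes the trivial one-element category with a single identity morphism.)
   Context: $A\to B$ means $\hom_{\mathbf{C}}(A,B)\ne\varnothing$. A category is locally small if every $\hom_{\mathbf{C}}(A,B)$ is a set. A category is thin if every hom-set has at most one element; a preorder is viewed as a thin category with exactly one morphism $a\to b$ if $a\le b$ and none otherwise. The composition $f\cdot g$ means first $g$, then $f$. A morphism $f$ is mono if $f\cdot g=f\cdot h$ implies $g=h$ whenever the compositions make sense. A category is directed if for all objects $A,B$ there is an object $C$ with $A\to C$ and $B\to C$. A skeleton of $\mathbf{C}$ is a full subcategory containing exactly one representative of each isomorphism class of objects. For a locally small category $\mathbf{C}$, $C\longrightarrow(B)^A_k$ means that $A\to B\to C$ and for every $k$-coloring $\chi:\hom_{\mathbf{C}}(A,C)\to k=\{0,\dots,k-1\}$ there is $w\in\hom_{\mathbf{C}}(B,C)$ with $|\chi(w\cdot\hom_{\mathbf{C}}(A,B))|=1$. $\mathbf{C}$ has the Ramsey property if for every $k\in\mathbb{N}=\{1,2,\dots\}$ and all $A,B\in\mathrm{Ob}(\mathbf{C})$ with $A\to B$ there is $C\in\mathrm{Ob}(\mathbf{C})$ with $C\longrightarrow(B)^A_k$. A category $\mathbf{C}$ is a Ramsey category of finite objects if: $\mathbf{C}$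 is a locally small directed category whose morphisms are mono; $\mathbf{C}$ has the Ramsey property; the skeleton $\mathbf{S}$ of $\mathbf{C}$ has at most countably many objects; and for every $S\in\mathrm{Ob}(\mathbf{S})$ there are only finitely many morphisms in $\mathbf{S}$ whose codomain is $S$. Pre-adjunction: for locally small categories $\mathbf{B}$ and $\mathbf{C}$, a pair of maps $F:\mathrm{Ob}(\mathbf{B})\to\mathrm{Ob}(\mathbf{C})$, $H:\mathrm{Ob}(\mathbf{C})\to\mathrm{Ob}(\mathbf{B})$ (not required to be functorial) is a pre-adjunction from $\mathbf{B}$ to $\mathbf{C}$ if there is a family of maps $\Phi_{X,Y}:\hom_{\mathbf{C}}(F(X),Y)\to\hom_{\mathbf{B}}(X,H(Y))$ indexed by pairs $(X,Y)\in\mathrm{Ob}(\mathbf{B})\times\mathrm{Ob}(\mathbf{C})$ such that: (PA) for every $C\in\mathrm{Ob}(\mathbf{C})$, all $A,B\in\mathrm{Ob}(\mathbf{B})$, every $u\in\hom_{\mathbf{C}}(F(B),C)$ and every $f\in\hom_{\mathbf{B}}(A,B)$ there is a $v\in\hom_{\mathbf{C}}(F(A),F(B))$ with $\Phi_{B,C}(u)\cdot f=\Phi_{A,C}(u\cdot v)$. $\mathbf{B}\le_T\mathbf{C}$ means there is a pre-adjunction from $\mathbf{B}$ to $\mathbf{C}$; $\mathbf{B}\equiv_T\mathbf{C}$ means $\mathbf{B}\le_T\mathbf{C}$ and $\mathbf{C}\le_T\mathbf{B}$; $\mathbf{B}<_T\mathbf{C}$ means $\mathbf{B}\le_T\mathbf{C}$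 and not $\mathbf{B}\equiv_T\mathbf{C}$. *)

theory Defs
  imports Main "HOL-Library.FuncSet" "HOL-Library.Countable_Set"
begin

text \<open>
  Hom-sets are HOL sets, so every category below is locally small. The fields \<open>Dom\<close>, \<open>Cod\<close>,
  \<open>Id\<close> and \<open>Comp\<close> are total functions whose values are meaningful only on the carriers
  \<open>Ob\<close> and \<open>Mor\<close>. \<open>Comp C f g\<close> is \<open>f \<cdot> g\<close>: first \<open>g\<close>, then \<open>f\<close>.
\<close>

record ('o, 'm) category =
  Ob :: "'o set"
  Mor :: "'m set"
  Dom :: "'m \<Rightarrow> 'o"
  Cod :: "'m \<Rightarrow> 'o"
  Id :: "'o \<Rightarrow> 'm"
  Comp :: "'m \<Rightarrow> 'm \<Rightarrow> 'm"

definition hom :: "('o, 'm) category \<Rightarrow> 'o \<Rightarrow> 'o \<Rightarrow> 'm set" where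
  "hom C A B = {f \<in> Mor C. Dom C f = A \<and> Cod C f = B}"

locale category =
  fixes C :: "('o, 'm) category"
  assumes Dom_in_Ob: "f \<in> Mor C \<Longrightarrow> Dom C f \<in> Ob C"
    and Cod_in_Ob: "f \<in> Mor C \<Longrightarrow> Cod C f \<in> Ob C"
    and Id_in_hom: "A \<in> Ob C \<Longrightarrow> Id C A \<in> hom C A A"
    and Comp_in_hom: "\<lbrakk>f \<in> Mor C; g \<in> Mor C; Dom C f = Cod C g\<rbrakk>
          \<Longrightarrow> Comp C f g \<in> hom C (Dom C g) (Cod C f)"
    and Comp_Id_right: "f \<in> Mor C \<Longrightarrow> Comp C f (Id C (Dom C f)) = f"
    and Comp_Id_left: "f \<in> Mor C \<Longrightarrow> Comp C (Id C (Cod C f)) f = f"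
    and Comp_assoc: "\<lbrakk>f \<in> Mor C; g \<in> Mor C; h \<in> Mor C; Dom C f = Cod C g; Dom C g = Cod C h\<rbrakk>
          \<Longrightarrow> Comp C (Comp C f g) h = Comp C f (Comp C g h)"

definition arrow :: "('o, 'm) category \<Rightarrow> 'o \<Rightarrow> 'o \<Rightarrow> bool" where
  "arrow C A B \<longleftrightarrow> hom C A B \<noteq> {}"

definition thin :: "('o, 'm) category \<Rightarrow> bool" where
  "thin C \<longleftrightarrow> (\<forall>A\<in>Ob C. \<forall>B\<in>Ob C. \<forall>f\<in>hom C A B. \<forall>g\<in>hom C A B. f = g)"

definition mono_morphism :: "('o, 'm) category \<Rightarrow> 'm \<Rightarrow> bool" where
  "mono_morphism C f \<longleftrightarrow> f \<in> Mor C \<and>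
     (\<forall>g\<in>Mor C. \<forall>h\<in>Mor C. Cod C g = Dom C f \<longrightarrow> Cod C h = Dom C f \<longrightarrow>
        Comp C f g = Comp C f h \<longrightarrow> g = h)"

definition directed :: "('o, 'm) category \<Rightarrow> bool" where
  "directed C \<longleftrightarrow> (\<forall>A\<in>Ob C. \<forall>B\<in>Ob C. \<exists>D\<in>Ob C. arrow C A D \<and> arrow C B D)"

definition isomorphic :: "('o, 'm) category \<Rightarrow> 'o \<Rightarrow> 'o \<Rightarrow> bool" where
  "isomorphic C A B \<longleftrightarrow> (\<exists>f\<in>hom C A B. \<exists>g\<in>hom C B A.
     Comp C g f = Id C A \<and> Comp C f g = Id C B)"

definition full_subcategory :: "('o, 'm) category \<Rightarrow> 'o set \<Rightarrow> ('o, 'm) category" where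
  "full_subcategory C X =
     C\<lparr>Ob := X, Mor := {f \<in> Mor C. Dom C f \<in> X \<and> Cod C f \<in> X}\<rparr>"

definition is_skeleton :: "('o, 'm) category \<Rightarrow> ('o, 'm) category \<Rightarrow> bool" where
  "is_skeleton S C \<longleftrightarrow> (\<exists>X\<subseteq>Ob C. S = full_subcategory C X \<and>
     (\<forall>A\<in>Ob C. \<exists>!R. R \<in> X \<and> isomorphic C A R))"

text \<open>\<open>ramsey_arrow C D B A k\<close> is the partition relation \<open>D \<longlongrightarrow> (B)\<^sup>A\<^sub>k\<close> in \<open>C\<close>.\<close>

definition ramsey_arrow :: "('o, 'm) category \<Rightarrow> 'o \<Rightarrow> 'o \<Rightarrow> 'o \<Rightarrow> nat \<Rightarrow> bool" where
  "ramsey_arrow C D B A k \<longleftrightarrow> arrow C A B \<and> arrow C B D \<and>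
     (\<forall>\<chi> \<in> hom C A D \<rightarrow> {..<k}. \<exists>w\<in>hom C B D. card (\<chi> ` (Comp C w ` hom C A B)) = 1)"

definition ramsey_property :: "('o, 'm) category \<Rightarrow> bool" where
  "ramsey_property C \<longleftrightarrow> (\<forall>k\<ge>1. \<forall>A\<in>Ob C. \<forall>B\<in>Ob C. arrow C A B \<longrightarrow>
     (\<exists>D\<in>Ob C. ramsey_arrow C D B A k))"

text \<open>
  Skeletons exist by choice and are unique up to isomorphism, so it does not matter which
  one witnesses the last conjunct.
\<close>

definition ramsey_category_of_finite_objects :: "('o, 'm) category \<Rightarrow> bool" where
  "ramsey_category_of_finite_objects C \<longleftrightarrow>
     category C \<and> directed C \<and> (\<forall>f\<in>Mor C. mono_morphism C f) \<and> ramsey_property C \<and>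
     (\<exists>S. is_skeleton S C \<and> countable (Ob S) \<and>
        (\<forall>A\<in>Ob S. finite {f \<in> Mor S. Cod S f = A}))"

definition pre_adjunction ::
  "('o, 'm) category \<Rightarrow> ('p, 'n) category \<Rightarrow> ('o \<Rightarrow> 'p) \<Rightarrow> ('p \<Rightarrow> 'o) \<Rightarrow> bool" where
  "pre_adjunction B C F H \<longleftrightarrow> F \<in> Ob B \<rightarrow> Ob C \<and> H \<in> Ob C \<rightarrow> Ob B \<and>
     (\<exists>\<Phi> :: 'o \<Rightarrow> 'p \<Rightarrow> 'n \<Rightarrow> 'm.
        (\<forall>X\<in>Ob B. \<forall>Y\<in>Ob C. \<Phi> X Y \<in> hom C (F X) Y \<rightarrow> hom B X (H Y)) \<and>
        (\<forall>Z\<in>Ob C. \<forall>X\<in>Ob B. \<forall>Y\<in>Ob B. \<forall>u\<in>hom C (F Y) Z. \<forall>f\<in>hom B X Y.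
           \<exists>v\<in>hom C (F X) (F Y). Comp B (\<Phi> Y Z u) f = \<Phi> X Z (Comp C u v)))"

definition tukey_le :: "('o, 'm) category \<Rightarrow> ('p, 'n) category \<Rightarrow> bool"
    (infix \<open>\<le>\<^sub>T\<close> 50) where
  "B \<le>\<^sub>T C \<longleftrightarrow> (\<exists>F H. pre_adjunction B C F H)"

definition tukey_equiv :: "('o, 'm) category \<Rightarrow> ('p, 'n) category \<Rightarrow> bool"
    (infix \<open>\<equiv>\<^sub>T\<close> 50) where
  "B \<equiv>\<^sub>T C \<longleftrightarrow> B \<le>\<^sub>T C \<and> C \<le>\<^sub>T B"

definition tukey_less :: "('o, 'm) category \<Rightarrow> ('p, 'n) category \<Rightarrow> bool"
    (infix \<open><\<^sub>T\<close> 50) where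
  "B <\<^sub>T C \<longleftrightarrow> B \<le>\<^sub>T C \<and> \<not> B \<equiv>\<^sub>T C"

definition preorder_category :: "'a set \<Rightarrow> ('a \<Rightarrow> 'a \<Rightarrow> bool) \<Rightarrow> ('a, 'a \<times> 'a) category" where
  "preorder_category P le =
     \<lparr>Ob = P, Mor = {(a, b). a \<in> P \<and> b \<in> P \<and> le a b}, Dom = fst, Cod = snd,
      Id = (\<lambda>a. (a, a)), Comp = (\<lambda>f g. (fst g, snd f))\<rparr>"

definition omega_category :: "(nat, nat \<times> nat) category" where
  "omega_category = preorder_category UNIV (\<le>)"

definition one_category :: "(unit, unit) category" where
  "one_category = \<lparr>Ob = {()}, Mor = {()}, Dom = (\<lambda>_. ()), Cod = (\<lambda>_. ()),
     Id = (\<lambda>_. ()), Comp = (\<lambda>_ _. ())\<rparr>"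

lemma category_preorder_category:
  assumes "\<And>a. a \<in> P \<Longrightarrow> le a a"
    and "\<And>a b c. \<lbrakk>a \<in> P; b \<in> P; c \<in> P; le a b; le b c\<rbrakk> \<Longrightarrow> le a c"
  shows "category (preorder_category P le)"
  by unfold_locales (auto simp: preorder_category_def hom_def assms(1) dest: assms(2))

lemma category_omega_category: "category omega_category"
  unfolding omega_category_def by (rule category_preorder_category) auto

lemma category_one_category: "category one_category"
  by unfold_locales (auto simp: one_category_def hom_def)

end

theory Submission imports Defs begin

text \<open>
  If some object \<open>T\<close> receives an arrow from every object, then \<open>hom A T\<close> can be
  colored injectively with finitely many colors; pulling this coloring back along a mono
  \<open>D \<rightarrow> T\<close> and applying the Ramsey property shows that \<open>hom A B\<close> is a singleton. A
  non-thin category thus has no such \<open>T\<close>, and directedness yields a chain without arrows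
  backwards. Only finitely many members of the chain have an arrow to a given object, which gives
  \<open>\<omega> \<le>\<^sub>T C\<close>. Conversely a pre-adjunction from \<open>C\<close> to \<open>\<omega>\<close> satisfies
  \<open>\<Phi>(u) \<cdot> f = \<Phi>(u \<cdot> v) = \<Phi>(u) \<cdot> g\<close> for parallel \<open>f\<close> and
  \<open>g\<close>, since there is only one choice for \<open>u \<cdot> v\<close>; as \<open>\<Phi>(u)\<close> is mono,
  \<open>C\<close> is thin. When \<open>C\<close> is thin, enumerating the skeleton and sending \<open>A\<close> to the largest
  index of an object below \<open>A\<close> gives \<open>C \<le>\<^sub>T \<omega>\<close>.
\<close>

lemma omega_category_simps [simp]:
  "Ob omega_category = UNIV"
  "Comp omega_category f g = (fst g, snd f)"
  "f \<in> hom omega_category m n \<longleftrightarrow> m \<le> n \<and> f = (m, n)"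
  by (auto simp: omega_category_def preorder_category_def hom_def)

lemma one_category_simps [simp]:
  "Ob one_category = {()}"
  "hom one_category x y = {()}"
  by (auto simp: one_category_def hom_def)

section \<open>Pre-adjunctions between a category and \<open>1\<close> or
  \<open>\<omega>\<close>\<close>

context category
begin

lemma Comp_hom [intro]:
  assumes "f \<in> hom C B D" "g \<in> hom C A B"
  shows "Comp C f g \<in> hom C A D"
  using assms Comp_in_hom[of f g] by (auto simp: hom_def)

lemma arrow_refl: "A \<in> Ob C \<Longrightarrow> arrow C A A"
  using Id_in_hom by (auto simp: arrow_def)

lemma arrow_trans: "arrow C A B \<Longrightarrow> arrow C B D \<Longrightarrow> arrow C A D"
  unfolding arrow_def by blast

text \<open>In a thin category both sides of (PA) lie in the same hom-set, so arbitrary choices of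
  morphisms serve as \<open>\<Phi>\<close>. What remains is order-theoretic: \<open>bound\<close>
  makes the choice possible and \<open>mono\<close> supplies \<open>v\<close>.\<close>

lemma tukey_le_omega_if_thin:
  fixes F :: "'o \<Rightarrow> nat"
  assumes "thin C" and "H \<in> UNIV \<rightarrow> Ob C"
    and mono: "\<And>A B. \<lbrakk>A \<in> Ob C; B \<in> Ob C; arrow C A B\<rbrakk> \<Longrightarrow> F A \<le> F B"
    and bound: "\<And>A n. \<lbrakk>A \<in> Ob C; F A \<le> n\<rbrakk> \<Longrightarrow> arrow C A (H n)"
  shows "C \<le>\<^sub>T omega_category"
proof -
  define \<Phi> where "\<Phi> = (\<lambda>A n (u :: nat \<times> nat). SOME f. f \<in> hom C A (H n))"
  have \<Phi>: "\<Phi> A n u \<in> hom C A (H n)" if "A \<in> Ob C" "F A \<le> n" for A n u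
    using bound[OF that] unfolding \<Phi>_def arrow_def by (simp add: some_in_eq)
  have "\<exists>v\<in>hom omega_category (F A) (F B).
      Comp C (\<Phi> B n u) f = \<Phi> A n (Comp omega_category u v)"
    if "A \<in> Ob C" "B \<in> Ob C" "u \<in> hom omega_category (F B) n" "f \<in> hom C A B" for A B n u f
  proof
    have "arrow C A B"
      using that(4) by (auto simp: arrow_def)
    then have le: "F A \<le> F B" "F B \<le> n"
      using mono that by auto
    then show "(F A, F B) \<in> hom omega_category (F A) (F B)"
      by simp
    have "Comp C (\<Phi> B n u) f \<in> hom C A (H n)"
      using \<Phi>[OF that(2) le(2)] that(4) by blast
    moreover have "\<Phi> A n w \<in> hom C A (H n)" for w
      using \<Phi>[OF that(1)] le by simp
    ultimately show "Comp C (\<Phi> B n u) f = \<Phi> A n (Comp omega_category u (F A, F B))"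
      using assms(1,2) that(1) unfolding thin_def by blast
  qed
  then show ?thesis
    unfolding tukey_le_def pre_adjunction_def
    using assms(2) \<Phi> by (intro exI[of _ F] exI[of _ H] conjI exI[of _ \<Phi>]) auto
qed

lemma tukey_le_one_if_thin:
  assumes "thin C" "T \<in> Ob C" "\<And>A. A \<in> Ob C \<Longrightarrow> arrow C A T"
  shows "C \<le>\<^sub>T one_category"
proof -
  define \<Phi> where "\<Phi> = (\<lambda>A (y :: unit) (u :: unit). SOME f. f \<in> hom C A T)"
  have \<Phi>: "\<Phi> A y u \<in> hom C A T" if "A \<in> Ob C" for A y u
    using assms(3)[OF that] unfolding \<Phi>_def arrow_def by (simp add: some_in_eq)
  have "Comp C (\<Phi> B y u) f = \<Phi> A y w"
    if "A \<in> Ob C" "B \<in> Ob C" "f \<in> hom C A B" for A B y u w f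
    using assms(1,2) \<Phi> that unfolding thin_def by blast
  then show ?thesis
    unfolding tukey_le_def pre_adjunction_def using assms(2) \<Phi>
    by (intro exI[of _ "\<lambda>_. ()"] exI[of _ "\<lambda>_. T"] conjI exI[of _ \<Phi>]) auto
qed

lemma one_tukey_le:
  assumes "A \<in> Ob C"
  shows "one_category \<le>\<^sub>T C"
  unfolding tukey_le_def pre_adjunction_def using assms Id_in_hom[OF assms]
  by (intro exI[of _ "\<lambda>_. A"] exI[of _ "\<lambda>_. ()"] conjI exI[of _ "\<lambda>_ _ _. ()"]) auto

text \<open>Parallel morphisms of \<open>\<omega>\<close> agree, so the equation in (PA) is
  automatic. \<open>bound\<close> makes the pair \<open>(n, H A)\<close> a morphism of
  \<open>\<omega>\<close>, and \<open>mono\<close> supplies \<open>v\<close>.\<close>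

lemma omega_tukey_le:
  fixes F :: "nat \<Rightarrow> 'o"
  assumes "F \<in> UNIV \<rightarrow> Ob C"
    and mono: "\<And>m n. m \<le> n \<Longrightarrow> arrow C (F m) (F n)"
    and bound: "\<And>n A. \<lbrakk>A \<in> Ob C; arrow C (F n) A\<rbrakk> \<Longrightarrow> n \<le> H A"
  shows "omega_category \<le>\<^sub>T C"
proof -
  have "n \<le> H A" if "A \<in> Ob C" "u \<in> hom C (F n) A" for n A u
    using bound[of A n] that by (auto simp: arrow_def)
  moreover have "\<exists>v. v \<in> hom C (F m) (F n)" if "m \<le> n" for m n
    using mono[OF that] by (auto simp: arrow_def)
  ultimately show ?thesis
    unfolding tukey_le_def pre_adjunction_def using assms(1)
    by (intro exI[of _ F] exI[of _ H] conjI exI[of _ "\<lambda>n A _. (n, H A)"]) auto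
qed

lemma thin_if_tukey_le_omega:
  assumes "\<And>f. f \<in> Mor C \<Longrightarrow> mono_morphism C f" and "C \<le>\<^sub>T omega_category"
  shows "thin C"
proof -
  obtain F H where "pre_adjunction C omega_category F H"
    using assms(2) unfolding tukey_le_def by blast
  then obtain \<Phi> where
    "\<forall>A\<in>Ob C. \<forall>n\<in>UNIV. \<Phi> A n \<in> hom omega_category (F A) n \<rightarrow> hom C A (H n)" and
    PA: "\<forall>n\<in>UNIV. \<forall>A\<in>Ob C. \<forall>B\<in>Ob C. \<forall>u\<in>hom omega_category (F B) n. \<forall>f\<in>hom C A B.
      \<exists>v\<in>hom omega_category (F A) (F B).
        Comp C (\<Phi> B n u) f = \<Phi> A n (Comp omega_category u v)"
    unfolding pre_adjunction_def omega_category_simps(1) by (elim conjE exE)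
  then have \<Phi>: "\<Phi> A n \<in> hom omega_category (F A) n \<rightarrow> hom C A (H n)" if "A \<in> Ob C" for A n
    using that by blast
  have "f = g" if AB: "A \<in> Ob C" "B \<in> Ob C" and fg: "f \<in> hom C A B" "g \<in> hom C A B" for A B f g
  proof -
    \<comment> \<open>The target \<open>F B\<close> guarantees a morphism to which
      \<open>\<Phi>\<close> can be applied, namely the identity.\<close>
    define u where "u = (F B, F B)"
    have u: "u \<in> hom omega_category (F B) (F B)"
      by (simp add: u_def)
    have "Comp C (\<Phi> B (F B) u) h = \<Phi> A (F B) (F A, F B)" if "h \<in> hom C A B" for h
      using bspec[OF bspec[OF bspec[OF bspec[OF bspec[OF PA UNIV_I] AB(1)] AB(2)] u] that]
      by (auto simp: u_def)
    then have "Comp C (\<Phi> B (F B) u) f = Comp C (\<Phi> B (F B) u) g"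
      using fg by simp
    moreover have \<Phi>u: "\<Phi> B (F B) u \<in> hom C B (H (F B))"
      using \<Phi>[OF AB(2)] u by blast
    moreover have "mono_morphism C (\<Phi> B (F B) u)"
      using \<Phi>u assms(1) by (simp add: hom_def)
    ultimately show ?thesis
      using fg by (auto simp: mono_morphism_def hom_def)
  qed
  then show ?thesis
    unfolding thin_def by blast
qed

lemma unbounded_chain:
  assumes "directed C" and "Ob C \<noteq> {}"
    and no_top: "\<And>T. T \<in> Ob C \<Longrightarrow> \<exists>A\<in>Ob C. \<not> arrow C A T"
  obtains F :: "nat \<Rightarrow> 'o" where
    "F \<in> UNIV \<rightarrow> Ob C"
    "\<And>m n. m \<le> n \<Longrightarrow> arrow C (F m) (F n)"
    "\<And>m n. m < n \<Longrightarrow> \<not> arrow C (F n) (F m)"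
proof -
  \<comment> \<open>Take \<open>D\<close> without an arrow to \<open>A\<close> and let
    \<open>B\<close> be above \<open>A\<close> and \<open>D\<close>; an arrow from \<open>B\<close>
    to \<open>A\<close> would yield one from \<open>D\<close> to \<open>A\<close>.\<close>
  have "\<exists>B. B \<in> Ob C \<and> arrow C A B \<and> \<not> arrow C B A" if "A \<in> Ob C" for A
    using no_top[OF that] assms(1) that arrow_trans unfolding directed_def by meson
  then obtain F :: "nat \<Rightarrow> 'o" where Ob: "\<And>n. F n \<in> Ob C" and
    succ: "\<And>n. arrow C (F n) (F (Suc n)) \<and> \<not> arrow C (F (Suc n)) (F n)"
    using dependent_nat_choice[of "\<lambda>_ A. A \<in> Ob C" "\<lambda>_ A B. arrow C A B \<and> \<not> arrow C B A"]
      assms(2) by blast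
  have le: "arrow C (F m) (F n)" if "m \<le> n" for m n
    using that
  proof (induction n rule: dec_induct)
    case base
    then show ?case by (rule arrow_refl[OF Ob])
  next
    case (step k)
    then show ?case using succ arrow_trans by blast
  qed
  \<comment> \<open>Otherwise \<open>F (Suc m)\<close> would reach \<open>F m\<close> through
    \<open>F n\<close>.\<close>
  moreover have "\<not> arrow C (F n) (F m)" if "m < n" for m n
    using le[of "Suc m" n] succ[of m] that arrow_trans by (meson Suc_leI)
  ultimately show thesis
    using that Ob by blast
qed

end

section \<open>Categories with a countable skeleton having finitely many morphisms into each
  object\<close>

locale category_finite_objects = category C for C :: "('o, 'm) category" +
  fixes X :: "'o set" and rep :: "'o \<Rightarrow> 'o"
  assumes directed: "directed C"
    and mono: "f \<in> Mor C \<Longrightarrow> mono_morphism C f"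
    and X_subset: "X \<subseteq> Ob C"
    and countable_X: "countable X"
    and rep_in_X: "A \<in> Ob C \<Longrightarrow> rep A \<in> X"
    and isomorphic_rep: "A \<in> Ob C \<Longrightarrow> isomorphic C A (rep A)"
    and finite_morphisms: "R \<in> X \<Longrightarrow> finite {f \<in> Mor C. Dom C f \<in> X \<and> Cod C f = R}"
begin

lemma arrow_to_rep: "A \<in> Ob C \<Longrightarrow> arrow C A (rep A)"
  and arrow_from_rep: "A \<in> Ob C \<Longrightarrow> arrow C (rep A) A"
  using isomorphic_rep by (auto simp: isomorphic_def arrow_def)

lemma Comp_cancel_left:
  assumes "f \<in> hom C B D" "g \<in> hom C A B" "h \<in> hom C A B" "Comp C f g = Comp C f h"
  shows "g = h"
  using assms mono[of f] unfolding mono_morphism_def hom_def by auto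

text \<open>Such an \<open>R\<close> also has an arrow to \<open>rep A\<close>, so it is the domain
  of one of the finitely many skeleton morphisms into \<open>rep A\<close>.\<close>

lemma finite_below:
  assumes "A \<in> Ob C"
  shows "finite {R \<in> X. arrow C R A}"
proof (rule finite_subset)
  show "{R \<in> X. arrow C R A} \<subseteq> Dom C ` {f \<in> Mor C. Dom C f \<in> X \<and> Cod C f = rep A}"
  proof
    fix R assume "R \<in> {R \<in> X. arrow C R A}"
    moreover from this have "arrow C R (rep A)"
      using arrow_to_rep[OF assms] arrow_trans by blast
    ultimately show "R \<in> Dom C ` {f \<in> Mor C. Dom C f \<in> X \<and> Cod C f = rep A}"
      by (auto simp: arrow_def hom_def)
  qed
  show "finite (Dom C ` {f \<in> Mor C. Dom C f \<in> X \<and> Cod C f = rep A})"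
    using finite_morphisms rep_in_X assms by blast
qed

text \<open>Composing with \<open>j\<close> on the right and \<open>t\<close> on the left embeds the
  hom-set into one of the skeleton: \<open>t\<close> is mono, and \<open>j\<close> is undone by
  \<open>i\<close>.\<close>

lemma finite_hom:
  assumes "A \<in> Ob C" "B \<in> Ob C"
  shows "finite (hom C A B)"
proof -
  obtain i j where i: "i \<in> hom C A (rep A)" and j: "j \<in> hom C (rep A) A"
    and ji: "Comp C j i = Id C A"
    using isomorphic_rep[OF assms(1)] unfolding isomorphic_def by blast
  obtain t where t: "t \<in> hom C B (rep B)"
    using arrow_to_rep[OF assms(2)] by (auto simp: arrow_def)
  have split: "f = Comp C (Comp C f j) i" if "f \<in> hom C A B" for f
    using Comp_assoc[of f j i] Comp_Id_right[of f] i j ji that by (auto simp: hom_def)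
  have "inj_on (\<lambda>f. Comp C t (Comp C f j)) (hom C A B)"
  proof (rule inj_onI)
    fix f g assume fg: "f \<in> hom C A B" "g \<in> hom C A B"
      "Comp C t (Comp C f j) = Comp C t (Comp C g j)"
    then have "Comp C f j = Comp C g j"
      using Comp_cancel_left[OF t] j by blast
    then show "f = g"
      using split fg by metis
  qed
  moreover have "(\<lambda>f. Comp C t (Comp C f j)) ` hom C A B \<subseteq> hom C (rep A) (rep B)"
    using t j by blast
  moreover have "finite (hom C (rep A) (rep B))"
    by (rule finite_subset[OF _ finite_morphisms[of "rep B"]])
      (use assms rep_in_X in \<open>auto simp: hom_def\<close>)
  ultimately show ?thesis
    using finite_imageD finite_subset by blast
qed

lemma thin_if_ramsey_top:
  assumes "ramsey_property C" "T \<in> Ob C" and top: "\<And>A. A \<in> Ob C \<Longrightarrow> arrow C A T"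
  shows "thin C"
proof -
  have "f = g" if AB: "A \<in> Ob C" "B \<in> Ob C" and fg: "f \<in> hom C A B" "g \<in> hom C A B" for A B f g
  proof -
    \<comment> \<open>With this many colors \<open>h\<close> can give each morphism from
      \<open>A\<close> to \<open>T\<close> its own color.\<close>
    define k where "k = card (hom C A T)"
    obtain h where "bij_betw h (hom C A T) {0..<k}"
      using ex_bij_betw_finite_nat[OF finite_hom[OF AB(1) assms(2)]] unfolding k_def by blast
    then have inj_h: "inj_on h (hom C A T)" and h: "h ` hom C A T = {..<k}"
      by (auto simp: bij_betw_def lessThan_atLeast0)
    have "hom C A T \<noteq> {}"
      using top[OF AB(1)] by (simp add: arrow_def)
    then have "k \<ge> 1"
      using finite_hom[OF AB(1) assms(2)] by (simp add: k_def Suc_le_eq card_gt_0_iff)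
    moreover have "arrow C A B"
      using fg by (auto simp: arrow_def)
    ultimately obtain D where D: "D \<in> Ob C" "ramsey_arrow C D B A k"
      using assms(1) AB unfolding ramsey_property_def by blast
    obtain t where t: "t \<in> hom C D T"
      using top[OF D(1)] by (auto simp: arrow_def)
    define \<chi> where "\<chi> = (\<lambda>a. h (Comp C t a))"
    have "\<chi> \<in> hom C A D \<rightarrow> {..<k}"
      using h t unfolding \<chi>_def by blast
    then obtain w where w: "w \<in> hom C B D"
      and card: "card (\<chi> ` (Comp C w ` hom C A B)) = 1"
      using D(2) unfolding ramsey_arrow_def by blast
    obtain c where "\<chi> ` (Comp C w ` hom C A B) = {c}"
      using card by (auto simp: card_1_singleton_iff)
    then have "\<chi> (Comp C w a) = c" if "a \<in> hom C A B" for a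
      using that by (metis imageI singletonD)
    then have "\<chi> (Comp C w f) = \<chi> (Comp C w g)"
      using fg by simp
    \<comment> \<open>Equal colors mean equal morphisms into \<open>T\<close>; cancelling the monos
      \<open>t\<close> and \<open>w\<close> then leaves \<open>f = g\<close>.\<close>
    then have "Comp C t (Comp C w f) = Comp C t (Comp C w g)"
      unfolding \<chi>_def using inj_h t w fg by (auto dest: inj_onD)
    then show "f = g"
      using Comp_cancel_left t w fg by (meson Comp_hom)
  qed
  then show ?thesis
    unfolding thin_def by blast
qed

lemma omega_tukey_le_if_no_top:
  assumes "Ob C \<noteq> {}" "\<And>T. T \<in> Ob C \<Longrightarrow> \<exists>A\<in>Ob C. \<not> arrow C A T"
  shows "omega_category \<le>\<^sub>T C"
proof -
  obtain F where F: "F \<in> UNIV \<rightarrow> Ob C"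
    "\<And>m n. m \<le> n \<Longrightarrow> arrow C (F m) (F n)"
    "\<And>m n :: nat. m < n \<Longrightarrow> \<not> arrow C (F n) (F m)"
    using unbounded_chain[OF directed assms] by blast
  have Ob: "F n \<in> Ob C" for n
    using F(1) by blast
  \<comment> \<open>A common representative of \<open>F m\<close> and \<open>F n\<close> would give
    an arrow back from \<open>F n\<close> to \<open>F m\<close>.\<close>
  have "inj (\<lambda>n. rep (F n))"
  proof (rule linorder_injI)
    fix m n :: nat assume "m < n"
    then show "rep (F m) \<noteq> rep (F n)"
      using F(3) arrow_to_rep[OF Ob[of n]] arrow_from_rep[OF Ob[of m]] arrow_trans by metis
  qed
  then have "finite ((\<lambda>n. rep (F n)) -` {R \<in> X. arrow C R A})" if "A \<in> Ob C" for A
    using finite_vimageI finite_below[OF that] by blast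
  moreover have "{n. arrow C (F n) A} \<subseteq> (\<lambda>n. rep (F n)) -` {R \<in> X. arrow C R A}" for A
    using rep_in_X[OF Ob] arrow_trans[OF arrow_from_rep[OF Ob]] by auto
  ultimately have "finite {n. arrow C (F n) A}" if "A \<in> Ob C" for A
    using that finite_subset by blast
  \<comment> \<open>\<open>H A\<close> is the last index of the chain with an arrow to
    \<open>A\<close>. If there is none, \<open>Max {}\<close> is an arbitrary number, which is
    harmless because the bound then holds vacuously.\<close>
  then show ?thesis
    by (intro omega_tukey_le[where F = F and H = "\<lambda>A. Max {n. arrow C (F n) A}"])
      (use F in auto)
qed

lemma finite_upper_bound:
  assumes "finite S" "S \<subseteq> Ob C" "Ob C \<noteq> {}"
  shows "\<exists>T\<in>Ob C. \<forall>A\<in>S. arrow C A T"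
  using assms(1,2)
proof (induction rule: finite_induct)
  case empty
  then show ?case using assms(3) by blast
next
  case (insert A S)
  then obtain T where "T \<in> Ob C" "\<forall>A\<in>S. arrow C A T" by blast
  moreover obtain T' where "T' \<in> Ob C" "arrow C A T'" "arrow C T T'"
    using directed insert.prems \<open>T \<in> Ob C\<close> unfolding directed_def by blast
  ultimately show ?case using arrow_trans by blast
qed

text \<open>\<open>H n\<close> is an upper bound of the finitely many representatives of index at
  most \<open>n\<close>. If \<open>F A \<le> n\<close>, then \<open>rep A\<close> is among them, and
  \<open>A\<close> reaches \<open>H n\<close> through \<open>rep A\<close>.\<close>

lemma tukey_le_omega:
  assumes "thin C" "Ob C \<noteq> {}"
  shows "C \<le>\<^sub>T omega_category"
proof -
  define idx where "idx = to_nat_on X"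
  define below where "below A = {R \<in> X. arrow C R A}" for A
  define F where "F A = Max (idx ` below A)" for A
  have fin: "finite (idx ` below A)" if "A \<in> Ob C" for A
    using finite_below[OF that] by (simp add: below_def)
  \<comment> \<open>This keeps the set under \<open>Max\<close> nonempty and bounds the index of
    \<open>rep A\<close> by \<open>F A\<close>.\<close>
  have rep_below: "rep A \<in> below A" if "A \<in> Ob C" for A
    using rep_in_X arrow_from_rep that by (simp add: below_def)
  have "finite {R \<in> X. idx R \<le> n}" for n
    using finite_vimage_IntI[OF finite_atMost inj_on_to_nat_on[OF countable_X], of n]
    by (rule finite_subset[rotated]) (auto simp: idx_def)
  then have "\<exists>T\<in>Ob C. \<forall>R\<in>{R \<in> X. idx R \<le> n}. arrow C R T" for n
    using X_subset assms(2) by (intro finite_upper_bound) auto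
  then have "\<forall>n. \<exists>T. T \<in> Ob C \<and> (\<forall>R\<in>X. idx R \<le> n \<longrightarrow> arrow C R T)"
    by blast
  then obtain H where H: "\<And>n. H n \<in> Ob C" "\<And>n R. R \<in> X \<Longrightarrow> idx R \<le> n \<Longrightarrow> arrow C R (H n)"
    unfolding choice_iff by blast
  show ?thesis
  proof (rule tukey_le_omega_if_thin[OF assms(1)])
    show "H \<in> UNIV \<rightarrow> Ob C"
      using H(1) by blast
    show "F A \<le> F B" if "A \<in> Ob C" "B \<in> Ob C" "arrow C A B" for A B
      unfolding F_def
    proof (rule Max_mono)
      show "idx ` below A \<subseteq> idx ` below B"
        using that(3) arrow_trans unfolding below_def by blast
      show "idx ` below A \<noteq> {}"
        using rep_below[OF that(1)] by blast
    qed (rule fin[OF that(2)])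
    show "arrow C A (H n)" if "A \<in> Ob C" "F A \<le> n" for A n
    proof -
      have "idx (rep A) \<le> F A"
        unfolding F_def using fin[OF that(1)] rep_below[OF that(1)] by (intro Max_ge) auto
      then show ?thesis
        using H(2)[of "rep A" n] rep_in_X arrow_to_rep arrow_trans that by (meson le_trans)
    qed
  qed
qed

end

section \<open>The classification of Ramsey categories of finite objects\<close>

lemma category_finite_objects_if_ramsey_category:
  assumes "ramsey_category_of_finite_objects C"
  obtains X rep where "category_finite_objects C X rep"
proof -
  have C: "category C" "directed C" "\<forall>f\<in>Mor C. mono_morphism C f"
    using assms by (simp_all add: ramsey_category_of_finite_objects_def)
  obtain S where "is_skeleton S C" and countable: "countable (Ob S)"
    and finite: "\<forall>A\<in>Ob S. finite {f \<in> Mor S. Cod S f = A}"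
    using assms unfolding ramsey_category_of_finite_objects_def by (elim conjE exE)
  then obtain X where X: "X \<subseteq> Ob C" and S: "S = full_subcategory C X"
    and unique: "\<forall>A\<in>Ob C. \<exists>!R. R \<in> X \<and> isomorphic C A R"
    unfolding is_skeleton_def by (elim conjE exE)
  have "\<forall>A\<in>Ob C. \<exists>R. R \<in> X \<and> isomorphic C A R"
    using unique by (simp add: Ex1_def) blast
  then obtain rep where rep: "\<forall>A\<in>Ob C. rep A \<in> X \<and> isomorphic C A (rep A)"
    unfolding bchoice_iff by (elim exE)
  have "finite {f \<in> Mor C. Dom C f \<in> X \<and> Cod C f = R}" if "R \<in> X" for R
  proof -
    have "{f \<in> Mor C. Dom C f \<in> X \<and> Cod C f = R} = {f \<in> Mor S. Cod S f = R}"
      using that by (auto simp: S full_subcategory_def)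
    then show ?thesis
      using finite that by (simp add: S full_subcategory_def)
  qed
  then have "category_finite_objects_axioms C X rep"
    using C(2,3) X countable rep
    by unfold_locales (simp_all add: S full_subcategory_def)
  then have "category_finite_objects C X rep"
    using C(1) by (simp add: category_finite_objects_def)
  then show thesis by (rule that)
qed

theorem theorem4p5:
  fixes C :: "('o, 'm) category"
  assumes "ramsey_category_of_finite_objects C"
    and "Ob C \<noteq> {}"
  shows "(thin C \<longrightarrow> C \<equiv>\<^sub>T one_category \<or> C \<equiv>\<^sub>T omega_category) \<and>
         (\<not> thin C \<longrightarrow> omega_category <\<^sub>T C)"
proof -
  obtain X rep where "category_finite_objects C X rep"
    using category_finite_objects_if_ramsey_category[OF assms(1)] by blast
  then interpret category_finite_objects C X rep .
  have ramsey: "ramsey_property C"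
    using assms(1) by (simp add: ramsey_category_of_finite_objects_def)
  show ?thesis
  proof (intro conjI impI)
    assume thin: "thin C"
    show "C \<equiv>\<^sub>T one_category \<or> C \<equiv>\<^sub>T omega_category"
    \<comment> \<open>A top object gives equivalence with \<open>1\<close>; its absence gives
      equivalence with \<open>\<omega>\<close>.\<close>
    proof (cases "\<exists>T\<in>Ob C. \<forall>A\<in>Ob C. arrow C A T")
      case True
      then show ?thesis
        using tukey_le_one_if_thin[OF thin] one_tukey_le unfolding tukey_equiv_def by blast
    next
      case False
      then show ?thesis
        using tukey_le_omega[OF thin assms(2)] omega_tukey_le_if_no_top[OF assms(2)]
        unfolding tukey_equiv_def by blast
    qed
  next
    \<comment> \<open>By the Ramsey property there is no top object, which gives the inequality; it
      is strict because the reverse one would force thinness.\<close>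
    assume "\<not> thin C"
    then show "omega_category <\<^sub>T C"
      using omega_tukey_le_if_no_top[OF assms(2)] thin_if_ramsey_top[OF ramsey]
        thin_if_tukey_le_omega[OF mono]
      unfolding tukey_less_def tukey_equiv_def by blast
  qed
qed

end
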